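(* Let $R$ be the curvature tensor of the Levi-Civita connection $\nabla$ for a Riemannian $\mathcal{W}_3$-manifold $(M,P,g)$ and let $\tilde R$ be the curvature tensor of the Levi-Civita connection $\tilde\nabla$ for its associated manifold $(M,P,\tilde g)$. Then for all smooth vector fields $x,y,z,w$ on $M$, $$\begin{aligned}\tilde R(x,y,z,w)={}&R(x,y,z,Pw)-(\nabla_xF)(w,y,z)+(\nabla_yF)(w,x,z)\\&+g\bigl((\nabla_yP)z+(\nabla_zP)y,\ (\nabla_xP)Pw+(\nabla_wP)Px\bigr)\\&-g\bigl((\nabla_xP)z+(\nabla_zP)x,\ (\nabla_yP)Pw+(\nabla_wP)Py\bigr).\end{aligned}$$
   Context: A Riemannian almost product manifold $(M,P,g)$ is a smooth manifold $M$ with a $(1,1)$-tensor field $P$ and a Riemannian metric $g$ such that $P^2x=x$ and $g(Px,Py)=g(x,y)$ for all smooth vector fields $x,y$; it is assumed throughout that $\mathrm{tr}\,P=0$ (so $\dim M=2n$ is even). The associated manifold of $(M,P,g)$ is $(M,P,\tilde g)$, where $\tilde g(x,y)=g(x,Py)$ is an indefinite metric of signature $(n,n)$. Let $F(x,y,z)=g((\nabla_xP)y,z)$, where $\nabla$ is the Levi-Civita connection of $g$. A Riemannian $\mathcal{W}_3$-manifold is a Riemannian almost product manifold (with $\mathrm{tr}\,P=0$) satisfying $F(x,y,z)+F(y,z,x)+F(z,x,y)=0$ for all $x,y,z$. The curvature tensors are $R(x,y)z=\nabla_x\nabla_yz-\nabla_y\nabla_xz-\nabla_{[x,y]}z$,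 $R(x,y,z,w)=g(R(x,y)z,w)$, and $\tilde R(x,y)z=\tilde\nabla_x\tilde\nabla_yz-\tilde\nabla_y\tilde\nabla_xz-\tilde\nabla_{[x,y]}z$, $\tilde R(x,y,z,w)=\tilde g(\tilde R(x,y)z,w)$. *)

theory Defs
  imports "HOL-Analysis.Analysis" "HOL-Library.Function_Algebras"
begin

text \<open>Pointwise scaling. Together with the pointwise additive structure of Function_Algebras it turns
  real-valued functions, tangent vectors and vector fields into real vector spaces.\<close>

instantiation "fun" :: (type, real_vector) real_vector
begin

definition scaleR_fun :: "real \<Rightarrow> ('a \<Rightarrow> 'b) \<Rightarrow> 'a \<Rightarrow> 'b" where
  "scaleR_fun c f = (\<lambda>x. c *\<^sub>R f x)"

instance
  by standard (simp_all add: scaleR_fun_def fun_eq_iff scaleR_add_left scaleR_add_right)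

end

lemma scaleR_fun_apply [simp]: "(c *\<^sub>R f) x = c *\<^sub>R f x"
  by (simp add: scaleR_fun_def)


subsection \<open>Smooth manifolds\<close>

text \<open>For open \<open>S\<close>: \<open>k\<close> times continuously differentiable.\<close>

primrec Ck_on :: "nat \<Rightarrow> 'a::euclidean_space set \<Rightarrow> ('a \<Rightarrow> 'b::real_normed_vector) \<Rightarrow> bool" where
  "Ck_on 0 S f \<longleftrightarrow> continuous_on S f"
| "Ck_on (Suc k) S f \<longleftrightarrow>
     (\<forall>x\<in>S. f differentiable (at x)) \<and>
     (\<forall>v. Ck_on k S (\<lambda>x. frechet_derivative f (at x) v))"

definition smooth_on :: "'a::euclidean_space set \<Rightarrow> ('a \<Rightarrow> 'b::real_normed_vector) \<Rightarrow> bool" where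
  "smooth_on S f \<longleftrightarrow> (\<forall>k. Ck_on k S f)"

text \<open>A chart is a pair of its domain and its coordinate map; values of the coordinate map outside the
  domain are irrelevant. The manifold is the whole type \<open>'m\<close>, whose sort supplies the Hausdorff and
  second countability axioms; its dimension is \<open>DIM('e)\<close>. An atlas need not be maximal.\<close>

type_synonym ('m, 'e) atlas = "('m set \<times> ('m \<Rightarrow> 'e)) set"

definition smooth_atlas ::
    "('m::{t2_space,second_countable_topology}, 'e::euclidean_space) atlas \<Rightarrow> bool" where
  "smooth_atlas A \<longleftrightarrow>
     (\<Union>(U, \<phi>)\<in>A. U) = UNIV \<and>
     (\<forall>(U, \<phi>)\<in>A. open U \<and> open (\<phi> ` U) \<and> homeomorphism U (\<phi> ` U) \<phi> (inv_into U \<phi>)) \<and>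
     (\<forall>(U, \<phi>)\<in>A. \<forall>(V, \<psi>)\<in>A. smooth_on (\<phi> ` (U \<inter> V)) (\<psi> \<circ> inv_into U \<phi>))"

definition smooth_functions ::
    "('m::{t2_space,second_countable_topology}, 'e::euclidean_space) atlas \<Rightarrow> ('m \<Rightarrow> real) set" where
  "smooth_functions A = {f. \<forall>(U, \<phi>)\<in>A. smooth_on (\<phi> ` U) (f \<circ> inv_into U \<phi>)}"


subsection \<open>Tangent vectors and smooth vector fields\<close>

text \<open>Tangent vectors at \<open>p\<close> are the derivations at \<open>p\<close> of the algebra of smooth functions. As they are
  represented by total functions, they are made to vanish at non-smooth arguments, so that equality of
  tangent vectors is equality in HOL.\<close>

type_synonym 'm tangent = "('m \<Rightarrow> real) \<Rightarrow> real"
type_synonym 'm vfield = "'m \<Rightarrow> 'm tangent"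

definition tangent_space ::
    "('m::{t2_space,second_countable_topology}, 'e::euclidean_space) atlas \<Rightarrow> 'm \<Rightarrow> 'm tangent set" where
  "tangent_space A p = {v.
     (\<forall>f\<in>smooth_functions A. \<forall>h\<in>smooth_functions A.
        v (f + h) = v f + v h \<and> v (f * h) = f p * v h + h p * v f) \<and>
     (\<forall>c. \<forall>f\<in>smooth_functions A. v (c *\<^sub>R f) = c * v f) \<and>
     (\<forall>f. f \<notin> smooth_functions A \<longrightarrow> v f = 0)}"

definition vf_apply :: "'m vfield \<Rightarrow> ('m \<Rightarrow> real) \<Rightarrow> 'm \<Rightarrow> real" where
  "vf_apply X f = (\<lambda>p. X p f)"

definition vector_fields ::
    "('m::{t2_space,second_countable_topology}, 'e::euclidean_space) atlas \<Rightarrow> 'm vfield set" where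
  "vector_fields A = {X. (\<forall>p. X p \<in> tangent_space A p) \<and>
     (\<forall>f\<in>smooth_functions A. vf_apply X f \<in> smooth_functions A)}"

definition vf_scale :: "('m \<Rightarrow> real) \<Rightarrow> 'm vfield \<Rightarrow> 'm vfield" where
  "vf_scale f X = (\<lambda>p. f p *\<^sub>R X p)"

text \<open>If \<open>f\<close> is not smooth, both terms are the value of a derivation at \<open>0\<close>, hence zero.\<close>

definition lie_bracket :: "'m vfield \<Rightarrow> 'm vfield \<Rightarrow> 'm vfield" where
  "lie_bracket X Y = (\<lambda>p f. X p (vf_apply Y f) - Y p (vf_apply X f))"


subsection \<open>Tensor fields\<close>

text \<open>Tensor fields of type (1,1) and (0,2) are given by their values on each tangent space; they are
  smooth when they take smooth vector fields to smooth vector fields and functions, respectively.\<close>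

type_synonym 'm tensor11 = "'m \<Rightarrow> 'm tangent \<Rightarrow> 'm tangent"
type_synonym 'm tensor02 = "'m \<Rightarrow> 'm tangent \<Rightarrow> 'm tangent \<Rightarrow> real"

definition app11 :: "'m tensor11 \<Rightarrow> 'm vfield \<Rightarrow> 'm vfield" where
  "app11 P X = (\<lambda>p. P p (X p))"

definition app02 :: "'m tensor02 \<Rightarrow> 'm vfield \<Rightarrow> 'm vfield \<Rightarrow> 'm \<Rightarrow> real" where
  "app02 g X Y = (\<lambda>p. g p (X p) (Y p))"

definition tensor_field11 ::
    "('m::{t2_space,second_countable_topology}, 'e::euclidean_space) atlas \<Rightarrow> 'm tensor11 \<Rightarrow> bool" where
  "tensor_field11 A P \<longleftrightarrow>
     (\<forall>p. \<forall>v\<in>tangent_space A p. P p v \<in> tangent_space A p \<and>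
        (\<forall>w\<in>tangent_space A p. P p (v + w) = P p v + P p w) \<and>
        (\<forall>c. P p (c *\<^sub>R v) = c *\<^sub>R P p v)) \<and>
     (\<forall>X\<in>vector_fields A. app11 P X \<in> vector_fields A)"

definition riemannian_metric ::
    "('m::{t2_space,second_countable_topology}, 'e::euclidean_space) atlas \<Rightarrow> 'm tensor02 \<Rightarrow> bool" where
  "riemannian_metric A g \<longleftrightarrow>
     (\<forall>p. \<forall>v\<in>tangent_space A p.
        (\<forall>w\<in>tangent_space A p. g p v w = g p w v \<and>
           (\<forall>u\<in>tangent_space A p. g p (v + w) u = g p v u + g p w u) \<and>
           (\<forall>c. g p (c *\<^sub>R v) w = c * g p v w)) \<and>
        (v \<noteq> 0 \<longrightarrow> g p v v > 0)) \<and>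
     (\<forall>X\<in>vector_fields A. \<forall>Y\<in>vector_fields A. app02 g X Y \<in> smooth_functions A)"

text \<open>Trace of an endomorphism \<open>T\<close> of a finite-dimensional subspace \<open>V\<close>: the sum of the diagonal
  matrix entries with respect to any basis of \<open>V\<close>.\<close>

definition trace_on :: "'v::real_vector set \<Rightarrow> ('v \<Rightarrow> 'v) \<Rightarrow> real" where
  "trace_on V T = (let B = (SOME B. independent B \<and> span B = V)
                   in \<Sum>b\<in>B. representation B (T b) b)"


subsection \<open>Connections and curvature\<close>

text \<open>A connection is only constrained on smooth vector fields.\<close>

type_synonym 'm connection = "'m vfield \<Rightarrow> 'm vfield \<Rightarrow> 'm vfield"

definition affine_connection ::
    "('m::{t2_space,second_countable_topology}, 'e::euclidean_space) atlas \<Rightarrow> 'm connection \<Rightarrow> bool" where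
  "affine_connection A D \<longleftrightarrow>
     (\<forall>X\<in>vector_fields A. \<forall>Y\<in>vector_fields A.
        D X Y \<in> vector_fields A \<and>
        (\<forall>Z\<in>vector_fields A. D (X + Y) Z = D X Z + D Y Z \<and> D X (Y + Z) = D X Y + D X Z) \<and>
        (\<forall>f\<in>smooth_functions A.
           D (vf_scale f X) Y = vf_scale f (D X Y) \<and>
           D X (vf_scale f Y) = vf_scale (vf_apply X f) Y + vf_scale f (D X Y)))"

definition levi_civita ::
    "('m::{t2_space,second_countable_topology}, 'e::euclidean_space) atlas
      \<Rightarrow> 'm tensor02 \<Rightarrow> 'm connection \<Rightarrow> bool" where
  "levi_civita A g D \<longleftrightarrow>
     affine_connection A D \<and>
     (\<forall>X\<in>vector_fields A. \<forall>Y\<in>vector_fields A. D X Y - D Y X = lie_bracket X Y) \<and>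
     (\<forall>X\<in>vector_fields A. \<forall>Y\<in>vector_fields A. \<forall>Z\<in>vector_fields A.
        vf_apply X (app02 g Y Z) = app02 g (D X Y) Z + app02 g Y (D X Z))"

definition curvature :: "'m connection \<Rightarrow> 'm vfield \<Rightarrow> 'm vfield \<Rightarrow> 'm vfield \<Rightarrow> 'm vfield" where
  "curvature D X Y Z = D X (D Y Z) - D Y (D X Z) - D (lie_bracket X Y) Z"

definition curvature4 ::
    "'m tensor02 \<Rightarrow> 'm connection
      \<Rightarrow> 'm vfield \<Rightarrow> 'm vfield \<Rightarrow> 'm vfield \<Rightarrow> 'm vfield \<Rightarrow> 'm \<Rightarrow> real" where
  "curvature4 g D X Y Z W = app02 g (curvature D X Y Z) W"


subsection \<open>Riemannian almost product manifolds\<close>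

definition riemannian_almost_product_manifold ::
    "('m::{t2_space,second_countable_topology}, 'e::euclidean_space) atlas
      \<Rightarrow> 'm tensor11 \<Rightarrow> 'm tensor02 \<Rightarrow> bool" where
  "riemannian_almost_product_manifold A P g \<longleftrightarrow>
     smooth_atlas A \<and> tensor_field11 A P \<and> riemannian_metric A g \<and>
     (\<forall>X\<in>vector_fields A. app11 P (app11 P X) = X) \<and>
     (\<forall>X\<in>vector_fields A. \<forall>Y\<in>vector_fields A. app02 g (app11 P X) (app11 P Y) = app02 g X Y) \<and>
     (\<forall>p. trace_on (tangent_space A p) (P p) = 0)"

definition associated_metric :: "'m tensor11 \<Rightarrow> 'm tensor02 \<Rightarrow> 'm tensor02" where
  "associated_metric P g = (\<lambda>p v w. g p v (P p w))"

text \<open>The covariant derivative of \<open>P\<close> in direction \<open>X\<close>, applied to \<open>Y\<close>.\<close>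

definition nabla_P :: "'m connection \<Rightarrow> 'm tensor11 \<Rightarrow> 'm vfield \<Rightarrow> 'm vfield \<Rightarrow> 'm vfield" where
  "nabla_P D P X Y = D X (app11 P Y) - app11 P (D X Y)"

definition F_tensor ::
    "'m tensor11 \<Rightarrow> 'm tensor02 \<Rightarrow> 'm connection
      \<Rightarrow> 'm vfield \<Rightarrow> 'm vfield \<Rightarrow> 'm vfield \<Rightarrow> 'm \<Rightarrow> real" where
  "F_tensor P g D X Y Z = app02 g (nabla_P D P X Y) Z"

text \<open>The covariant derivative of \<open>F\<close> in direction \<open>X\<close>, applied to \<open>U\<close>, \<open>Y\<close>, \<open>Z\<close>.\<close>

definition nabla_F ::
    "'m tensor11 \<Rightarrow> 'm tensor02 \<Rightarrow> 'm connection
      \<Rightarrow> 'm vfield \<Rightarrow> 'm vfield \<Rightarrow> 'm vfield \<Rightarrow> 'm vfield \<Rightarrow> 'm \<Rightarrow> real" where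
  "nabla_F P g D X U Y Z =
     vf_apply X (F_tensor P g D U Y Z)
     - F_tensor P g D (D X U) Y Z - F_tensor P g D U (D X Y) Z - F_tensor P g D U Y (D X Z)"

text \<open>The last argument is the Levi-Civita connection of \<open>g\<close>, which is part of the data.\<close>

definition riemannian_W3_manifold ::
    "('m::{t2_space,second_countable_topology}, 'e::euclidean_space) atlas
      \<Rightarrow> 'm tensor11 \<Rightarrow> 'm tensor02 \<Rightarrow> 'm connection \<Rightarrow> bool" where
  "riemannian_W3_manifold A P g D \<longleftrightarrow>
     riemannian_almost_product_manifold A P g \<and> levi_civita A g D \<and>
     (\<forall>X\<in>vector_fields A. \<forall>Y\<in>vector_fields A. \<forall>Z\<in>vector_fields A.
        F_tensor P g D X Y Z + F_tensor P g D Y Z X + F_tensor P g D Z X Y = 0)"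

end

theory Submission
  imports Defs
begin

text \<open>Comparing the Koszul characterisations of the two Levi-Civita connections, the \<open>\<W>\<^sub>3\<close> identity
  gives \<open>\<nabla>~\<^sub>x y = \<nabla>\<^sub>x y + \<Phi>(x,y)\<close> with \<open>\<Phi>(x,y) = P((\<nabla>\<^sub>x P)y + (\<nabla>\<^sub>y P)x)\<close>; equivalently
  \<open>g(\<Phi>(x,y), Pw) = - F(w,x,y)\<close>. In the usual formula for the curvature of \<open>\<nabla> + \<Phi>\<close>,
  the derivative of \<open>\<Phi>\<close> produces the derivatives of \<open>F\<close> together with \<open>g(\<Phi>(y,z), (\<nabla>\<^sub>x P)w)\<close>, which
  cancels against a part of \<open>\<Phi>(x, \<Phi>(y,z))\<close>; the rest is quadratic in \<open>\<nabla>P\<close>.\<close>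

section \<open>Calculus of \<open>k\<close> times continuously differentiable functions on open
  sets\<close>

lemma frechet_derivative_cong_open:
  assumes "open S" "x \<in> S" "f differentiable (at x)" "\<And>y. y \<in> S \<Longrightarrow> f y = h y"
  shows "h differentiable (at x)" "frechet_derivative h (at x) = frechet_derivative f (at x)"
proof -
  have "(f has_derivative frechet_derivative f (at x)) (at x)"
    using assms(3) frechet_derivative_works by blast
  then have "(h has_derivative frechet_derivative f (at x)) (at x)"
    using assms has_derivative_transform_within_open by blast
  then show "h differentiable (at x)" "frechet_derivative h (at x) = frechet_derivative f (at x)"
    by (auto simp: differentiable_def dest: frechet_derivative_at[symmetric])
qed

text \<open>The differentiation rules used below describe derivatives at points of \<open>S\<close>
  only, while the recursion of \<open>Ck_on\<close> speaks of total functions. As \<open>S\<close>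
  is open, the values on \<open>S\<close> determine the derivatives there at every order.\<close>

lemma Ck_on_cong:
  assumes "open S" "Ck_on k S f" "\<And>y. y \<in> S \<Longrightarrow> f y = h y"
  shows "Ck_on k S h"
  using assms(2,3)
proof (induction k arbitrary: f h)
  case 0
  then show ?case by (metis Ck_on.simps(1) continuous_on_cong)
next
  case (Suc k)
  have *: "h differentiable (at x)" "frechet_derivative h (at x) = frechet_derivative f (at x)"
    if "x \<in> S" for x
    using frechet_derivative_cong_open[OF assms(1) that _ Suc.prems(2)] Suc.prems(1) that by auto
  have "Ck_on k S (\<lambda>x. frechet_derivative h (at x) v)" for v
    using Suc.IH[of "\<lambda>x. frechet_derivative f (at x) v"] Suc.prems(1) * by simp
  then show ?case
    using * by simp
qed

lemma Ck_on_add: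
  assumes "open S" "Ck_on k S f" "Ck_on k S h"
  shows "Ck_on k S (\<lambda>x. f x + h x)"
  using assms(2,3)
proof (induction k arbitrary: f h)
  case 0
  then show ?case by (auto intro: continuous_intros)
next
  case (Suc k)
  have "frechet_derivative (\<lambda>x. f x + h x) (at x)
      = (\<lambda>v. frechet_derivative f (at x) v + frechet_derivative h (at x) v)" if "x \<in> S" for x
    using that Suc.prems
    by (intro frechet_derivative_at[symmetric] has_derivative_add)
       (auto simp: frechet_derivative_works[symmetric])
  then show ?case
    using Suc.prems by (auto intro: Ck_on_cong[OF assms(1) Suc.IH])
qed

lemma Ck_on_scaleR:
  assumes "open S" "Ck_on k S f"
  shows "Ck_on k S (\<lambda>x. c *\<^sub>R f x)"
  using assms(2)
proof (induction k arbitrary: f)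
  case 0
  then show ?case by (auto intro: continuous_intros)
next
  case (Suc k)
  have d: "((\<lambda>x. c *\<^sub>R f x) has_derivative (\<lambda>v. c *\<^sub>R frechet_derivative f (at x) v)) (at x)"
    if "x \<in> S" for x
    using that Suc.prems
    by (intro has_derivative_scaleR_right) (auto simp: frechet_derivative_works[symmetric])
  then have "frechet_derivative (\<lambda>x. c *\<^sub>R f x) (at x)
      = (\<lambda>v. c *\<^sub>R frechet_derivative f (at x) v)" if "x \<in> S" for x
    using that by (intro frechet_derivative_at[symmetric])
  then show ?case
    using Suc.prems d by (auto intro: Ck_on_cong[OF assms(1) Suc.IH] simp: differentiable_def)
qed

section \<open>Linear structure on smooth functions and vector fields\<close>

locale smooth_manifold =
  fixes A :: "('m::{t2_space,second_countable_topology}, 'e::euclidean_space) atlas"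
  assumes atlas: "smooth_atlas A"
begin

lemma smooth_functions_add:
  assumes "f \<in> smooth_functions A" "h \<in> smooth_functions A"
  shows "f + h \<in> smooth_functions A"
proof -
  have "smooth_on (\<phi> ` U) ((f + h) \<circ> inv_into U \<phi>)" if "(U, \<phi>) \<in> A" for U \<phi>
  proof -
    have "open (\<phi> ` U)"
      using atlas that by (auto simp: smooth_atlas_def)
    moreover have "smooth_on (\<phi> ` U) (f \<circ> inv_into U \<phi>)" "smooth_on (\<phi> ` U) (h \<circ> inv_into U \<phi>)"
      using assms that by (auto simp: smooth_functions_def)
    ultimately show ?thesis
      by (simp add: smooth_on_def o_def Ck_on_add)
  qed
  then show ?thesis by (auto simp: smooth_functions_def)
qed

lemma smooth_functions_scaleR:
  assumes "f \<in> smooth_functions A"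
  shows "c *\<^sub>R f \<in> smooth_functions A"
proof -
  have "smooth_on (\<phi> ` U) ((c *\<^sub>R f) \<circ> inv_into U \<phi>)" if "(U, \<phi>) \<in> A" for U \<phi>
  proof -
    have "open (\<phi> ` U)"
      using atlas that by (auto simp: smooth_atlas_def)
    moreover have "smooth_on (\<phi> ` U) (f \<circ> inv_into U \<phi>)"
      using assms that by (auto simp: smooth_functions_def)
    \<comment> \<open>Scaling of reals is rewritten to multiplication by the simplifier, so the rule
      is brought into that form first.\<close>
    ultimately show ?thesis
      by (simp add: smooth_on_def o_def Ck_on_scaleR[where 'b = real, unfolded real_scaleR_def])
  qed
  then show ?thesis by (auto simp: smooth_functions_def)
qed

lemma tangent_space_add:
  "v \<in> tangent_space A p \<Longrightarrow> w \<in> tangent_space A p \<Longrightarrow> v + w \<in> tangent_space A p"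
  by (auto simp: tangent_space_def algebra_simps)

lemma tangent_space_scaleR:
  "v \<in> tangent_space A p \<Longrightarrow> c *\<^sub>R v \<in> tangent_space A p"
  by (auto simp: tangent_space_def algebra_simps)

lemma vector_fields_add:
  assumes "X \<in> vector_fields A" "Y \<in> vector_fields A"
  shows "X + Y \<in> vector_fields A"
proof -
  have "vf_apply (X + Y) f = vf_apply X f + vf_apply Y f" for f
    by (auto simp: vf_apply_def)
  then show ?thesis
    using assms by (auto simp: vector_fields_def intro: smooth_functions_add tangent_space_add)
qed

lemma vector_fields_scaleR:
  assumes "X \<in> vector_fields A"
  shows "c *\<^sub>R X \<in> vector_fields A"
proof -
  have "vf_apply (c *\<^sub>R X) f = c *\<^sub>R vf_apply X f" for f
    by (auto simp: vf_apply_def)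
  then show ?thesis
    using assms by (auto simp: vector_fields_def intro: smooth_functions_scaleR tangent_space_scaleR)
qed

lemma vector_fields_diff:
  assumes "X \<in> vector_fields A" "Y \<in> vector_fields A"
  shows "X - Y \<in> vector_fields A"
  using vector_fields_add[OF assms(1) vector_fields_scaleR[OF assms(2), of "-1"]] by simp

lemma vf_apply_uminus:
  assumes "X \<in> vector_fields A" "f \<in> smooth_functions A"
  shows "vf_apply X (- f) = - vf_apply X f"
proof
  fix p
  have "X p ((-1) *\<^sub>R f) = (-1) * X p f"
    using assms unfolding vector_fields_def tangent_space_def by blast
  then show "vf_apply X (- f) p = (- vf_apply X f) p"
    by (simp add: vf_apply_def)
qed

lemma connection_closed:
  "affine_connection A D \<Longrightarrow> X \<in> vector_fields A \<Longrightarrow> Y \<in> vector_fields A \<Longrightarrow> D X Y \<in> vector_fields A"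
  by (simp add: affine_connection_def)

lemma connection_add:
  assumes "affine_connection A D"
    and "X \<in> vector_fields A" "Y \<in> vector_fields A" "Z \<in> vector_fields A"
  shows "D (X + Y) Z = D X Z + D Y Z" "D X (Y + Z) = D X Y + D X Z"
  using assms by (auto simp: affine_connection_def)

text \<open>Additivity applied to \<open>(X - Y) + Y\<close>; the rules for differences under
  \<open>PP\<close> and \<open>G\<close> below arise in the same way.\<close>

lemma connection_diff:
  assumes "affine_connection A D"
    and "X \<in> vector_fields A" "Y \<in> vector_fields A" "Z \<in> vector_fields A"
  shows "D (X - Y) Z = D X Z - D Y Z" "D X (Y - Z) = D X Y - D X Z"
  using connection_add(1)[OF assms(1) vector_fields_diff[OF assms(2,3)] assms(3,4)]
    connection_add(2)[OF assms(1,2) vector_fields_diff[OF assms(3,4)] assms(4)]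
  by auto

end

section \<open>Pointwise algebra of the metric and the involution\<close>

locale almost_product_manifold =
  fixes A :: "('m::{t2_space,second_countable_topology}, 'e::euclidean_space) atlas"
    and P :: "'m tensor11" and g :: "'m tensor02"
  assumes almost_product: "riemannian_almost_product_manifold A P g"

sublocale almost_product_manifold \<subseteq> smooth_manifold
  using almost_product by unfold_locales (simp add: riemannian_almost_product_manifold_def)

context almost_product_manifold
begin

abbreviation "G \<equiv> app02 g"
abbreviation "PP \<equiv> app11 P"

lemma P_closed: "X \<in> vector_fields A \<Longrightarrow> PP X \<in> vector_fields A"
  using almost_product by (simp add: riemannian_almost_product_manifold_def tensor_field11_def)

lemma P_P: "X \<in> vector_fields A \<Longrightarrow> PP (PP X) = X"
  using almost_product by (simp add: riemannian_almost_product_manifold_def)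

lemma P_add:
  assumes "X \<in> vector_fields A" "Y \<in> vector_fields A"
  shows "PP (X + Y) = PP X + PP Y"
  using assms almost_product
  by (auto simp: riemannian_almost_product_manifold_def tensor_field11_def vector_fields_def app11_def
      fun_eq_iff)

lemma P_diff:
  assumes "X \<in> vector_fields A" "Y \<in> vector_fields A"
  shows "PP (X - Y) = PP X - PP Y"
  using P_add[OF vector_fields_diff[OF assms] assms(2)] by simp

lemma metric: "riemannian_metric A g"
  using almost_product by (simp add: riemannian_almost_product_manifold_def)

lemma G_smooth: "X \<in> vector_fields A \<Longrightarrow> Y \<in> vector_fields A \<Longrightarrow> G X Y \<in> smooth_functions A"
  using metric by (simp add: riemannian_metric_def)

lemma G_commute: "X \<in> vector_fields A \<Longrightarrow> Y \<in> vector_fields A \<Longrightarrow> G X Y = G Y X"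
  using metric by (auto simp: riemannian_metric_def app02_def vector_fields_def)

lemma G_add_left:
  assumes "X \<in> vector_fields A" "Y \<in> vector_fields A" "Z \<in> vector_fields A"
  shows "G (X + Y) Z = G X Z + G Y Z"
  using assms metric by (auto simp: riemannian_metric_def app02_def vector_fields_def)

lemma G_add_right:
  assumes "X \<in> vector_fields A" "Y \<in> vector_fields A" "Z \<in> vector_fields A"
  shows "G Z (X + Y) = G Z X + G Z Y"
  using G_add_left[OF assms] G_commute[of Z] vector_fields_add assms by simp

lemma G_diff_left:
  assumes "X \<in> vector_fields A" "Y \<in> vector_fields A" "Z \<in> vector_fields A"
  shows "G (X - Y) Z = G X Z - G Y Z"
  using G_add_left[OF vector_fields_diff[OF assms(1,2)] assms(2,3)] by simp

lemma G_diff_right: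
  assumes "X \<in> vector_fields A" "Y \<in> vector_fields A" "Z \<in> vector_fields A"
  shows "G Z (X - Y) = G Z X - G Z Y"
  using G_add_right[OF vector_fields_diff[OF assms(1,2)] assms(2,3)] by simp

text \<open>Positive definiteness at each point. This is the nondegeneracy that determines the
  associated connection in \<open>D'_eq\<close>.\<close>

lemma G_definite:
  assumes "X \<in> vector_fields A" "G X X = 0"
  shows "X = 0"
proof
  fix p
  have "X p \<in> tangent_space A p"
    using assms(1) by (simp add: vector_fields_def)
  then have "X p \<noteq> 0 \<longrightarrow> g p (X p) (X p) > 0"
    using metric unfolding riemannian_metric_def by blast
  moreover have "g p (X p) (X p) = 0"
    using fun_cong[OF assms(2), of p] by (simp add: app02_def)
  ultimately show "X p = 0 p"
    by (metis less_irrefl zero_fun_apply)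
qed

lemma G_P_P: "X \<in> vector_fields A \<Longrightarrow> Y \<in> vector_fields A \<Longrightarrow> G (PP X) (PP Y) = G X Y"
  using almost_product by (simp add: riemannian_almost_product_manifold_def)

text \<open>An isometric involution is self-adjoint: apply the isometry property to \<open>X\<close>
  and \<open>PP Y\<close>.\<close>

lemma G_P_left: "X \<in> vector_fields A \<Longrightarrow> Y \<in> vector_fields A \<Longrightarrow> G (PP X) Y = G X (PP Y)"
  using G_P_P[of X "PP Y"] by (simp add: P_closed P_P)

lemma app02_associated: "app02 (associated_metric P g) X Y = G X (PP Y)"
  by (simp add: app02_def associated_metric_def app11_def)

end

section \<open>The Levi-Civita connection and the symmetries of the derivative of
  \<open>P\<close>\<close>

locale almost_product_manifold_connection = almost_product_manifold +
  fixes D :: "'a connection"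
  assumes levi_civita: "levi_civita A g D"
begin

abbreviation "N \<equiv> nabla_P D P"
abbreviation "F \<equiv> F_tensor P g D"

lemma affine: "affine_connection A D"
  using levi_civita by (simp add: levi_civita_def)

lemmas D_closed = connection_closed[OF affine]
lemmas D_add = connection_add[OF affine]
lemmas D_diff = connection_diff[OF affine]

lemma torsion_free: "X \<in> vector_fields A \<Longrightarrow> Y \<in> vector_fields A \<Longrightarrow> lie_bracket X Y = D X Y - D Y X"
  using levi_civita by (simp add: levi_civita_def)

lemma metric_compatible:
  assumes "X \<in> vector_fields A" "Y \<in> vector_fields A" "Z \<in> vector_fields A"
  shows "vf_apply X (G Y Z) = G (D X Y) Z + G Y (D X Z)"
  using assms levi_civita by (simp add: levi_civita_def)

lemma N_closed: "X \<in> vector_fields A \<Longrightarrow> Y \<in> vector_fields A \<Longrightarrow> N X Y \<in> vector_fields A"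
  by (simp add: nabla_P_def D_closed P_closed vector_fields_diff)

lemmas closed = D_closed N_closed P_closed vector_fields_add vector_fields_diff

lemma N_add:
  assumes "X \<in> vector_fields A" "Y \<in> vector_fields A" "Z \<in> vector_fields A"
  shows "N (X + Y) Z = N X Z + N Y Z" "N X (Y + Z) = N X Y + N X Z"
  using assms by (simp_all add: nabla_P_def D_add P_add closed)

lemma N_diff:
  assumes "X \<in> vector_fields A" "Y \<in> vector_fields A" "Z \<in> vector_fields A"
  shows "N (X - Y) Z = N X Z - N Y Z" "N X (Y - Z) = N X Y - N X Z"
  using assms by (simp_all add: nabla_P_def D_diff P_diff closed)

text \<open>Differentiating \<open>P^2 = id\<close> makes the covariant derivative of
  \<open>P\<close> anticommute with \<open>P\<close>.\<close>

lemma N_P: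
  assumes "X \<in> vector_fields A" "Y \<in> vector_fields A"
  shows "N X (PP Y) = - PP (N X Y)"
  using assms by (simp add: nabla_P_def P_diff P_P closed)

text \<open>Obtained by differentiating the self-adjointness \<open>G (PP Y) Z = G Y (PP Z)\<close>
  along \<open>X\<close>.\<close>

lemma F_commute:
  assumes "X \<in> vector_fields A" "Y \<in> vector_fields A" "Z \<in> vector_fields A"
  shows "F X Y Z = F X Z Y"
proof -
  have "G (D X (PP Y)) Z + G Y (PP (D X Z)) = G (PP (D X Y)) Z + G Y (D X (PP Z))"
    using assms metric_compatible[of X "PP Y" Z] metric_compatible[of X Y "PP Z"]
    by (simp add: G_P_left closed)
  then have "G (N X Y) Z = G Y (N X Z)"
    using assms by (simp add: nabla_P_def G_diff_left G_diff_right closed fun_eq_iff algebra_simps)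
  then show ?thesis
    using assms by (simp add: F_tensor_def G_commute[of Y] closed)
qed

end

section \<open>Comparison of the two Levi-Civita connections\<close>

locale W3_manifold =
  fixes A :: "('m::{t2_space,second_countable_topology}, 'e::euclidean_space) atlas"
    and P :: "'m tensor11" and g :: "'m tensor02" and D D' :: "'m connection"
  assumes W3: "riemannian_W3_manifold A P g D"
    and levi_civita_associated: "levi_civita A (associated_metric P g) D'"

sublocale W3_manifold \<subseteq> almost_product_manifold_connection
  using W3 by unfold_locales (simp_all add: riemannian_W3_manifold_def)

context W3_manifold
begin

definition \<Phi> :: "'m vfield \<Rightarrow> 'm vfield \<Rightarrow> 'm vfield" where
  "\<Phi> X Y = PP (N X Y + N Y X)"

lemma \<Phi>_closed: "X \<in> vector_fields A \<Longrightarrow> Y \<in> vector_fields A \<Longrightarrow> \<Phi> X Y \<in> vector_fields A"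
  by (simp add: \<Phi>_def closed)

lemma F_cyclic:
  assumes "X \<in> vector_fields A" "Y \<in> vector_fields A" "Z \<in> vector_fields A"
  shows "F X Y Z + F Y Z X + F Z X Y = 0"
  using assms W3 by (simp add: riemannian_W3_manifold_def)

lemma G_\<Phi>_P:
  assumes "X \<in> vector_fields A" "Y \<in> vector_fields A" "Z \<in> vector_fields A"
  shows "G (\<Phi> X Y) (PP Z) = F X Y Z + F Y X Z"
  using assms by (simp add: \<Phi>_def F_tensor_def G_P_P G_add_left closed)

text \<open>The cyclic identity collapses the two terms of \<open>G_\<Phi>_P\<close> into one. A
  single value of \<open>F\<close> is what can be differentiated later to produce
  \<open>nabla_F\<close>.\<close>

lemma G_\<Phi>_P_cyclic:
  assumes "X \<in> vector_fields A" "Y \<in> vector_fields A" "Z \<in> vector_fields A"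
  shows "G (\<Phi> X Y) (PP Z) = - F Z X Y"
  using G_\<Phi>_P[OF assms] F_cyclic[OF assms] F_commute[OF assms(2,1,3)]
  by (simp add: eq_neg_iff_add_eq_0)

lemma affine_associated: "affine_connection A D'"
  using levi_civita_associated by (simp add: levi_civita_def)

text \<open>Koszul's argument for the difference \<open>T\<close> of the connections:
  \<open>T\<close> is symmetric because both are torsion free, and compatibility with the associated
  metric gives a linear system that determines \<open>T\<close>.\<close>

lemma D'_eq:
  assumes "X \<in> vector_fields A" "Y \<in> vector_fields A"
  shows "D' X Y = D X Y + \<Phi> X Y"
proof -
  define T where "T X Y = D' X Y - D X Y" for X Y
  have T_closed: "T X Y \<in> vector_fields A" if "X \<in> vector_fields A" "Y \<in> vector_fields A" for X Y
    using that by (simp add: T_def closed connection_closed[OF affine_associated])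
  have T_commute: "T X Y = T Y X" if "X \<in> vector_fields A" "Y \<in> vector_fields A" for X Y
  proof -
    have "D' X Y - D' Y X = D X Y - D Y X"
      using that levi_civita_associated torsion_free[of X Y] by (simp add: levi_civita_def)
    then show ?thesis by (simp add: T_def algebra_simps)
  qed
  have T_metric: "G (T X Y) (PP Z) + G (T X Z) (PP Y) = F X Y Z"
    if XYZ: "X \<in> vector_fields A" "Y \<in> vector_fields A" "Z \<in> vector_fields A" for X Y Z
  proof -
    \<comment> \<open>Both sides are the derivative of \<open>G Y (PP Z)\<close> along
      \<open>X\<close>: on the left by compatibility of \<open>D'\<close> with the associated
      metric, on the right by that of \<open>D\<close> with \<open>g\<close>.\<close>
    have "G (D' X Y) (PP Z) + G Y (PP (D' X Z)) = G (D X Y) (PP Z) + G Y (D X (PP Z))"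
      using that levi_civita_associated metric_compatible[of X Y "PP Z"]
      by (simp add: levi_civita_def app02_associated closed)
    moreover have "G Y (D X (PP Z)) = G Y (PP (D X Z)) + F X Z Y"
      using that by (simp add: F_tensor_def nabla_P_def G_diff_right closed G_commute[of _ Y])
    ultimately have "G (T X Y) (PP Z) + G Y (PP (T X Z)) = F X Z Y"
      using that
      by (simp add: T_def G_diff_left G_diff_right P_diff closed connection_closed[OF affine_associated]
          fun_eq_iff algebra_simps)
    moreover have "G Y (PP (T X Z)) = G (T X Z) (PP Y)"
      using that by (simp add: G_commute[of Y] T_closed closed G_P_left)
    ultimately show ?thesis using F_commute[OF XYZ] by simp
  qed
  define E where "E = T X Y - \<Phi> X Y"
  have E: "E \<in> vector_fields A"
    using assms by (simp add: E_def T_closed \<Phi>_closed closed)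
  have "G E (PP Z) = 0" if Z: "Z \<in> vector_fields A" for Z
  proof
    fix p
    \<comment> \<open>By symmetry of \<open>T\<close>, the three instances of
      \<open>T_metric\<close> involve only three unknowns. They give
      \<open>2 G (T X Y) (PP Z) = F X Y Z + F Y X Z - F Z X Y\<close>, and by the cyclic identity
      the right-hand side is twice \<open>F X Y Z + F Y X Z\<close>.\<close>
    have "G E (PP Z) p = G (T X Y) (PP Z) p - (F X Y Z p + F Y X Z p)"
      using assms Z by (simp add: E_def G_diff_left T_closed \<Phi>_closed closed G_\<Phi>_P)
    moreover have "G (T X Y) (PP Z) p + G (T X Z) (PP Y) p = F X Y Z p"
      using T_metric[OF assms Z] by (simp add: fun_eq_iff)
    moreover have "G (T X Y) (PP Z) p + G (T Y Z) (PP X) p = F Y X Z p"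
      using fun_cong[OF T_metric[OF assms(2,1) Z], of p] T_commute[OF assms] by simp
    moreover have "G (T X Z) (PP Y) p + G (T Y Z) (PP X) p = F Z X Y p"
      using fun_cong[OF T_metric[OF Z assms], of p] T_commute[OF assms(1) Z] T_commute[OF assms(2) Z]
      by simp
    moreover have "F X Y Z p + F Y X Z p + F Z X Y p = 0"
      using F_cyclic[OF assms Z] F_commute[OF assms(2,1) Z] by (simp add: fun_eq_iff)
    ultimately show "G E (PP Z) p = 0 p" by simp
  qed
  \<comment> \<open>The choice \<open>Z = PP E\<close> turns \<open>PP Z\<close> into
    \<open>E\<close>, so \<open>G E E = 0\<close>.\<close>
  from this[of "PP E"] have "E = 0"
    using E by (simp add: P_P closed G_definite)
  then show ?thesis by (simp add: E_def T_def algebra_simps)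
qed

section \<open>From the difference of the connections to that of the curvatures\<close>

lemma \<Phi>_add_right:
  assumes "X \<in> vector_fields A" "Y \<in> vector_fields A" "Z \<in> vector_fields A"
  shows "\<Phi> X (Y + Z) = \<Phi> X Y + \<Phi> X Z"
  using assms by (simp add: \<Phi>_def N_add P_add closed)

lemma \<Phi>_diff_left:
  assumes "X \<in> vector_fields A" "Y \<in> vector_fields A" "Z \<in> vector_fields A"
  shows "\<Phi> (X - Y) Z = \<Phi> X Z - \<Phi> Y Z"
  using assms by (simp add: \<Phi>_def N_diff P_add P_diff closed)

text \<open>Inserting \<open>D' = D + \<Phi>\<close> twice gives four terms, rewritten one by one in
  steps 1 to 4. The result is arranged for antisymmetrisation in \<open>X\<close> and
  \<open>Y\<close>, which completes the terms in \<open>F\<close> to \<open>nabla_F\<close>.\<close>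

lemma G_D'_D'_P:
  assumes "X \<in> vector_fields A" "Y \<in> vector_fields A" "Z \<in> vector_fields A" "W \<in> vector_fields A"
  shows "G (D' X (D' Y Z)) (PP W) = G (D X (D Y Z)) (PP W) - vf_apply X (F W Y Z)
    + F (D X W) Y Z - F W X (D Y Z) - G (\<Phi> Y Z) (PP (\<Phi> X W))"
  (is "?lhs = _")
proof -
  have 1: "?lhs = G (D X (D Y Z)) (PP W) + G (D X (\<Phi> Y Z)) (PP W)
      + G (\<Phi> X (D Y Z)) (PP W) + G (\<Phi> X (\<Phi> Y Z)) (PP W)"
    using assms
    by (simp add: D'_eq closed \<Phi>_closed D_add \<Phi>_add_right G_add_left algebra_simps)
  \<comment> \<open>Tangent vectors are linear on smooth functions, which lets \<open>X\<close> pass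
    the minus sign of \<open>G_\<Phi>_P_cyclic\<close>.\<close>
  have "F W Y Z \<in> smooth_functions A"
    using assms by (simp add: F_tensor_def G_smooth closed)
  then have "- vf_apply X (F W Y Z) = vf_apply X (G (\<Phi> Y Z) (PP W))"
    using assms by (simp add: G_\<Phi>_P_cyclic vf_apply_uminus)
  moreover have "\<dots> = G (D X (\<Phi> Y Z)) (PP W) + G (\<Phi> Y Z) (D X (PP W))"
    using assms by (simp add: metric_compatible closed \<Phi>_closed)
  \<comment> \<open>\<open>P\<close> need not be parallel; \<open>N X W\<close> measures how
    \<open>D X (PP W)\<close> differs from \<open>PP (D X W)\<close>.\<close>
  moreover have "G (\<Phi> Y Z) (N X W) = G (\<Phi> Y Z) (D X (PP W)) - G (\<Phi> Y Z) (PP (D X W))"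
    using assms by (simp add: nabla_P_def G_diff_right closed \<Phi>_closed)
  moreover have "G (\<Phi> Y Z) (PP (D X W)) = - F (D X W) Y Z"
    using assms by (simp add: closed G_\<Phi>_P_cyclic)
  ultimately have 2: "G (D X (\<Phi> Y Z)) (PP W)
      = - vf_apply X (F W Y Z) - G (\<Phi> Y Z) (N X W) + F (D X W) Y Z"
    by (simp add: fun_eq_iff algebra_simps)
  have 3: "G (\<Phi> X (D Y Z)) (PP W) = - F W X (D Y Z)"
    using assms by (simp add: G_\<Phi>_P_cyclic closed)
  \<comment> \<open>\<open>G_\<Phi>_P\<close> gives two values of \<open>F\<close>. The one with
    first argument \<open>\<Phi> Y Z\<close> is minus the quadratic term, by the cyclic form; the
    other cancels \<open>G (\<Phi> Y Z) (N X W)\<close> from step 2.\<close>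
  have "G (\<Phi> X (\<Phi> Y Z)) (PP W) + G (\<Phi> Y Z) (PP (\<Phi> X W)) = F X (\<Phi> Y Z) W"
  proof -
    have "G (\<Phi> Y Z) (PP (\<Phi> X W)) = G (\<Phi> X W) (PP (\<Phi> Y Z))"
      using assms by (simp add: G_commute[of "\<Phi> Y Z"] closed \<Phi>_closed G_P_left)
    also have "\<dots> = - F (\<Phi> Y Z) X W"
      using assms by (simp add: G_\<Phi>_P_cyclic closed \<Phi>_closed)
    finally show ?thesis
      using assms by (simp add: G_\<Phi>_P closed \<Phi>_closed)
  qed
  moreover have "F X (\<Phi> Y Z) W = G (\<Phi> Y Z) (N X W)"
    using assms F_commute[of X "\<Phi> Y Z" W] by (simp add: F_tensor_def G_commute closed \<Phi>_closed)
  ultimately have 4: "G (\<Phi> X (\<Phi> Y Z)) (PP W) = G (\<Phi> Y Z) (N X W) - G (\<Phi> Y Z) (PP (\<Phi> X W))"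
    by (simp add: fun_eq_iff algebra_simps)
  show ?thesis
    unfolding 1 2 3 4 by simp
qed

text \<open>The isometry \<open>P\<close> cancels against the outer \<open>PP\<close> of
  \<open>\<Phi> Y Z\<close>. Moving \<open>PP\<close> inside \<open>\<Phi> X W\<close> costs a sign
  by \<open>N_P\<close>, which yields the form of the quadratic terms in the theorem.\<close>

lemma G_\<Phi>_P_\<Phi>:
  assumes "X \<in> vector_fields A" "Y \<in> vector_fields A" "Z \<in> vector_fields A" "W \<in> vector_fields A"
  shows "G (\<Phi> Y Z) (PP (\<Phi> X W)) = - G (N Y Z + N Z Y) (N X (PP W) + N W (PP X))"
proof -
  have "N X (PP W) + N W (PP X) = 0 - \<Phi> X W"
    using assms by (simp add: N_P \<Phi>_def P_add closed)
  \<comment> \<open>The zero field enters as \<open>V - V\<close>, so that negation reduces to the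
    rule for differences.\<close>
  moreover have "G S (0 - V) = - G S V" if "S \<in> vector_fields A" "V \<in> vector_fields A" for S V
    using vector_fields_diff[of V V] G_diff_right[of 0 V S] G_diff_right[of V V S] that by simp
  ultimately show ?thesis
    using assms by (simp add: \<Phi>_def G_P_P closed)
qed

lemma curvature_associated:
  assumes "X \<in> vector_fields A" "Y \<in> vector_fields A" "Z \<in> vector_fields A" "W \<in> vector_fields A"
  shows "curvature4 (associated_metric P g) D' X Y Z W =
      curvature4 g D X Y Z (PP W) - nabla_F P g D X W Y Z + nabla_F P g D Y W X Z
      + G (N Y Z + N Z Y) (N X (PP W) + N W (PP X))
      - G (N X Z + N Z X) (N Y (PP W) + N W (PP Y))"
proof -
  have bracket: "lie_bracket X Y \<in> vector_fields A"
    using assms by (simp add: torsion_free closed)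
  have 1: "curvature4 (associated_metric P g) D' X Y Z W
     = G (D' X (D' Y Z)) (PP W) - G (D' Y (D' X Z)) (PP W) - G (D' (lie_bracket X Y) Z) (PP W)"
    using assms bracket
    by (simp add: curvature4_def curvature_def app02_associated G_diff_left closed
        connection_closed[OF affine_associated])
  have 2: "curvature4 g D X Y Z (PP W)
     = G (D X (D Y Z)) (PP W) - G (D Y (D X Z)) (PP W) - G (D (lie_bracket X Y) Z) (PP W)"
    using assms bracket by (simp add: curvature4_def curvature_def G_diff_left closed)
  have "G (D' (lie_bracket X Y) Z) (PP W)
     = G (D (lie_bracket X Y) Z) (PP W) + G (\<Phi> (lie_bracket X Y) Z) (PP W)"
    using assms bracket by (simp add: D'_eq G_add_left closed \<Phi>_closed)
  \<comment> \<open>Since the bracket is \<open>D X Y - D Y X\<close>, it supplies the terms of the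
    two \<open>nabla_F\<close> in which the third argument of \<open>nabla_F\<close> is
    differentiated into the middle slot of \<open>F\<close>.\<close>
  moreover have "G (\<Phi> (lie_bracket X Y) Z) (PP W) = - F W (D X Y) Z + F W (D Y X) Z"
    using assms by (simp add: torsion_free \<Phi>_diff_left G_diff_left G_\<Phi>_P_cyclic closed \<Phi>_closed)
  ultimately have 3: "G (D' (lie_bracket X Y) Z) (PP W)
     = G (D (lie_bracket X Y) Z) (PP W) - F W (D X Y) Z + F W (D Y X) Z"
    by (simp add: fun_eq_iff)
  \<comment> \<open>The term \<open>F W Y (D X Z)\<close> of \<open>nabla_F P g D X W Y Z\<close>
    comes from the instance with \<open>X\<close> and \<open>Y\<close> exchanged, and symmetrically
    for the other derivative.\<close>
  show ?thesis
    unfolding 1 2 3 G_D'_D'_P[OF assms] G_D'_D'_P[OF assms(2,1,3,4)] nabla_F_def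
      G_\<Phi>_P_\<Phi>[OF assms] G_\<Phi>_P_\<Phi>[OF assms(2,1,3,4)]
    by (simp add: fun_eq_iff)
qed

end

theorem theorem4p2:
  fixes A :: "('m::{t2_space,second_countable_topology}, 'e::euclidean_space) atlas"
    and P :: "'m tensor11" and g :: "'m tensor02"
    and D D' :: "'m connection"
    and x y z w :: "'m vfield"
  assumes "riemannian_W3_manifold A P g D"
    and "levi_civita A (associated_metric P g) D'"
    and "x \<in> vector_fields A" and "y \<in> vector_fields A"
    and "z \<in> vector_fields A" and "w \<in> vector_fields A"
  shows "curvature4 (associated_metric P g) D' x y z w =
      curvature4 g D x y z (app11 P w)
      - nabla_F P g D x w y z + nabla_F P g D y w x z
      + app02 g (nabla_P D P y z + nabla_P D P z y)
                (nabla_P D P x (app11 P w) + nabla_P D P w (app11 P x))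
      - app02 g (nabla_P D P x z + nabla_P D P z x)
                (nabla_P D P y (app11 P w) + nabla_P D P w (app11 P y))"
proof -
  interpret W3_manifold A P g D D'
    using assms(1,2) by unfold_locales
  show ?thesis
    using assms(3-6) by (rule curvature_associated)
qed

end
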